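(* Let $n\ge 3$ be an integer. If $n$ is even, then $b_3(n)=n/2$. If $n$ is odd, then $b_3(n)=(n-1)/2$ or $b_3(n)=(n+1)/2$. Moreover, if $n$ is odd and either $n\equiv 1\pmod 8$ or $n$ is a power of $3$, then $b_3(n)=(n-1)/2$.
   Context: $K_n^{(3)}$ denotes the collection of all $3$-element subsets of an $n$-element vertex set. A complete $3$-partite $3$-graph (on this vertex set) is specified by three pairwise disjoint sets $A_1,A_2,A_3$ of vertices, and consists of those $3$-sets that meet every $A_i$. The sets $A_1,A_2,A_3$ need not cover the vertex set. A set of complete $3$-partite $3$-graphs is an odd cover of $K_n^{(3)}$ if each $3$-set is in an odd number of these complete $3$-partite $3$-graphs. The odd cover number $b_3(n)$ is the smallest size of an odd cover of $K_n^{(3)}$. *)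

theory Defs
  imports Main
begin

definition K3 :: "nat \<Rightarrow> nat set set" where
  "K3 n = {e. e \<subseteq> {..<n} \<and> card e = 3}"

definition tripartite_edges ::
    "nat \<Rightarrow> nat set \<Rightarrow> nat set \<Rightarrow> nat set \<Rightarrow> nat set set" where
  "tripartite_edges n A B C =
    {e \<in> K3 n. e \<inter> A \<noteq> {} \<and> e \<inter> B \<noteq> {} \<and> e \<inter> C \<noteq> {}}"

(* A 3-graph on {..<n} is identified with its edge set. Parts may be empty, in which
   case the graph has no edges; such graphs never help in a smallest odd cover. *)
definition complete_tripartite :: "nat \<Rightarrow> nat set set \<Rightarrow> bool" where
  "complete_tripartite n H \<longleftrightarrow>
    (\<exists>A B C. A \<subseteq> {..<n} \<and> B \<subseteq> {..<n} \<and> C \<subseteq> {..<n} \<and>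
      A \<inter> B = {} \<and> A \<inter> C = {} \<and> B \<inter> C = {} \<and>
      H = tripartite_edges n A B C)"

(* Such a family is automatically finite, so card below is the true cardinality. *)
definition odd_cover :: "nat \<Rightarrow> nat set set set \<Rightarrow> bool" where
  "odd_cover n F \<longleftrightarrow>
    (\<forall>H\<in>F. complete_tripartite n H) \<and>
    (\<forall>e\<in>K3 n. odd (card {H \<in> F. e \<in> H}))"

definition b3 :: "nat \<Rightarrow> nat" where
  "b3 n = (LEAST k. \<exists>F. odd_cover n F \<and> card F = k)"

lemma odd_cover_finite:
  assumes "odd_cover n F"
  shows "finite F"
proof (rule finite_subset)
  show "F \<subseteq> Pow (K3 n)"
  proof
    fix H assume "H \<in> F"
    with assms have "complete_tripartite n H"
      by (simp add: odd_cover_def)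
    then obtain A B C where H: "H = tripartite_edges n A B C"
      by (auto simp only: complete_tripartite_def)
    show "H \<in> Pow (K3 n)"
      unfolding H tripartite_edges_def by simp
  qed
  have "finite (K3 n)"
    by (rule finite_subset[of _ "Pow {..<n}"]) (auto simp: K3_def)
  then show "finite (Pow (K3 n))"
    by simp
qed

(* The minimum in b3 is taken over a nonempty set: use the single-edge graphs. *)
lemma odd_cover_exists: "\<exists>F. odd_cover n F"
proof
  let ?F = "(\<lambda>e. {e}) ` K3 n"
  have tri: "complete_tripartite n {e}" if e: "e \<in> K3 n" for e
  proof -
    from e have sub: "e \<subseteq> {..<n}" and c: "card e = 3" by (auto simp: K3_def)
    from c obtain x y z where xyz: "e = {x, y, z}" "x \<noteq> y" "x \<noteq> z" "y \<noteq> z"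
      unfolding card_3_iff by blast
    have uniq: "f = e" if f: "f \<in> tripartite_edges n {x} {y} {z}" for f
    proof -
      from f have "e \<subseteq> f" "card f = 3"
        unfolding tripartite_edges_def K3_def xyz(1) by simp_all
      moreover from this(2) have "finite f" by (simp add: card_ge_0_finite)
      ultimately show ?thesis using c card_subset_eq[of f e] by simp
    qed
    have mem: "e \<in> tripartite_edges n {x} {y} {z}"
      using e unfolding tripartite_edges_def xyz(1) by simp
    have eq: "{e} = tripartite_edges n {x} {y} {z}"
    proof (intro set_eqI iffI)
      fix f assume "f \<in> {e}"
      with mem show "f \<in> tripartite_edges n {x} {y} {z}" by simp
    next
      fix f assume "f \<in> tripartite_edges n {x} {y} {z}"
      from uniq[OF this] show "f \<in> {e}" by simp
    qed
    have parts: "{x} \<subseteq> {..<n}" "{y} \<subseteq> {..<n}" "{z} \<subseteq> {..<n}"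
      using sub unfolding xyz(1) by simp_all
    have disj: "{x} \<inter> {y} = {}" "{x} \<inter> {z} = {}" "{y} \<inter> {z} = {}"
      using xyz(2-4) by simp_all
    show ?thesis
      unfolding complete_tripartite_def
      by (rule exI[of _ "{x}"], rule exI[of _ "{y}"], rule exI[of _ "{z}"],
          intro conjI parts disj eq)
  qed
  have single: "{H \<in> ?F. e \<in> H} = {{e}}" if "e \<in> K3 n" for e
  proof (intro set_eqI iffI)
    fix H assume "H \<in> {H \<in> ?F. e \<in> H}"
    then obtain e' where "H = {e'}" "e \<in> H" by blast
    then show "H \<in> {{e}}" by simp
  next
    fix H assume "H \<in> {{e}}"
    with that show "H \<in> {H \<in> ?F. e \<in> H}" by simp
  qed
  have "odd (card {H \<in> ?F. e \<in> H})" if "e \<in> K3 n" for e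
    unfolding single[OF that] by simp
  with tri show "odd_cover n ?F"
    unfolding odd_cover_def by simp
qed

end

theory Submission
  imports Defs
begin

text \<open>
  Lower bound: the link of a vertex turns an odd cover of size \<open>k\<close> into \<open>k\<close> bicliques
  \<open>(P H, Q H)\<close> covering every edge of \<open>K\<close> on the remaining \<open>m = n - 1\<close> vertices an odd number
  of times. A nonempty vertex set meeting all \<open>P H\<close> and \<open>Q H\<close> in even sets must be the whole
  vertex set, and then \<open>m\<close> is odd; counting over \<open>GF(2)\<close> gives \<open>2 * k \<ge> m\<close> for even and
  \<open>2 * k \<ge> m - 1\<close> for odd \<open>m\<close>, where disjointness of \<open>P H\<close> and \<open>Q H\<close> excludes equality.

  Upper bound: for \<open>n = 2 * m\<close> pair up the vertices and fix a tournament \<open>t\<close> on the pairs. The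
  \<open>i\<close>-th graph has pair \<open>i\<close> as one part; every other pair \<open>j\<close> is split between the remaining
  two parts, in the order dictated by \<open>t i j\<close>. If \<open>m\<close> is even and all in-degrees are even, one
  more vertex can be added to the part of pair \<open>i\<close> in every graph. For powers of three, take
  the linear functionals on \<open>GF(3)\<^sup>k\<close> up to sign, each giving the partition into its level sets.
\<close>

section \<open>Lower bound\<close>

lemma triple_in_tripartite_edges_iff:
  assumes "x < n" "y < n" "z < n" "x \<noteq> y" "x \<noteq> z" "y \<noteq> z"
  shows "{x, y, z} \<in> tripartite_edges n A B C \<longleftrightarrow>
    {x, y, z} \<inter> A \<noteq> {} \<and> {x, y, z} \<inter> B \<noteq> {} \<and> {x, y, z} \<inter> C \<noteq> {}"
  using assms by (simp add: tripartite_edges_def K3_def)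

section \<open>Parity linear algebra of biclique covers\<close>

lemma odd_card_sym_diff_Int:
  assumes "finite X" "finite Y"
  shows "odd (card (((X - Y) \<union> (Y - X)) \<inter> P)) \<longleftrightarrow> odd (card (X \<inter> P)) \<noteq> odd (card (Y \<inter> P))"
proof -
  have "X \<inter> P = (X - Y) \<inter> P \<union> X \<inter> Y \<inter> P" by blast
  then have "card (X \<inter> P) = card ((X - Y) \<inter> P) + card (X \<inter> Y \<inter> P)"
    using card_Un_disjoint[of "(X - Y) \<inter> P" "X \<inter> Y \<inter> P"] assms(1) by (simp only:) blast
  moreover have "Y \<inter> P = (Y - X) \<inter> P \<union> X \<inter> Y \<inter> P" by blast
  then have "card (Y \<inter> P) = card ((Y - X) \<inter> P) + card (X \<inter> Y \<inter> P)"
    using card_Un_disjoint[of "(Y - X) \<inter> P" "X \<inter> Y \<inter> P"] assms by (simp only:) blast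
  moreover have "card (((X - Y) \<union> (Y - X)) \<inter> P) = card ((X - Y) \<inter> P) + card ((Y - X) \<inter> P)"
    using card_Un_disjoint[of "(X - Y) \<inter> P" "(Y - X) \<inter> P"] assms
    by (simp add: Int_Un_distrib2) blast
  ultimately show ?thesis by auto
qed

text \<open>Bicliques are indexed by \<open>F\<close> rather than collected in a set, because
  different members of a cover may have the same link.\<close>

locale biclique_cover =
  fixes V :: "'a set" and F :: "'i set" and P Q :: "'i \<Rightarrow> 'a set"
  assumes finite_V: "finite V" and finite_F: "finite F"
    and disjoint: "H \<in> F \<Longrightarrow> P H \<inter> Q H = {}"
    and cover: "u \<in> V \<Longrightarrow> v \<in> V \<Longrightarrow> u \<noteq> v \<Longrightarrow>
      odd (card {H \<in> F. (u \<in> P H \<and> v \<in> Q H) \<or> (v \<in> P H \<and> u \<in> Q H)})"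
begin

text \<open>A linear map from \<open>GF(2)\<close>-vectors on \<open>V\<close> to vectors with
  \<open>2 * card F\<close> coordinates, both encoded as sets.\<close>

definition signature :: "'a set \<Rightarrow> 'i set \<times> 'i set" where
  "signature X = ({H \<in> F. odd (card (X \<inter> P H))}, {H \<in> F. odd (card (X \<inter> Q H))})"

lemma finite_sub: "X \<subseteq> V \<Longrightarrow> finite X"
  using finite_V finite_subset by blast

text \<open>Count pairs of a biclique and an edge of it from \<open>v\<close> to
  \<open>X - {v}\<close>. Each \<open>u\<close> contributes an odd number; each \<open>H\<close>
  contributes the size of the part of \<open>X\<close> on the side opposite to \<open>v\<close>,
  which by disjointness does not contain \<open>v\<close>.\<close>

lemma odd_degree:
  assumes X: "X \<subseteq> V" and v: "v \<in> V"
  shows "odd (card (X - {v})) \<longleftrightarrow>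
    odd (card {H \<in> F. (v \<in> P H \<and> odd (card (X \<inter> Q H))) \<or> (v \<in> Q H \<and> odd (card (X \<inter> P H)))})"
proof -
  let ?R = "\<lambda>H u. (u \<in> P H \<and> v \<in> Q H) \<or> (v \<in> P H \<and> u \<in> Q H)"
  have fX: "finite (X - {v})" using finite_sub[OF X] by simp
  have "{u \<in> X - {v}. odd (card {H \<in> F. ?R H u})} = X - {v}"
    using cover X v by blast
  then have "odd (card (X - {v})) \<longleftrightarrow> odd (\<Sum>u\<in>X - {v}. card {H \<in> F. ?R H u})"
    using even_sum_iff[OF fX, of "\<lambda>u. card {H \<in> F. ?R H u}"] by simp
  also have "(\<Sum>u\<in>X - {v}. card {H \<in> F. ?R H u}) = (\<Sum>H\<in>F. card {u \<in> X - {v}. ?R H u})"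
    using sum_multicount_gen[OF fX finite_F, of "\<lambda>u H. ?R H u"
        "\<lambda>H. card {u \<in> X - {v}. ?R H u}"] by simp
  also have "odd \<dots> \<longleftrightarrow> odd (card {H \<in> F. odd (card {u \<in> X - {v}. ?R H u})})"
    using even_sum_iff[OF finite_F] by simp
  also have "{H \<in> F. odd (card {u \<in> X - {v}. ?R H u})} =
      {H \<in> F. (v \<in> P H \<and> odd (card (X \<inter> Q H))) \<or> (v \<in> Q H \<and> odd (card (X \<inter> P H)))}"
  proof (rule Collect_cong, rule conj_cong[OF refl])
    fix H assume H: "H \<in> F"
    consider "v \<in> P H" "v \<notin> Q H" | "v \<in> Q H" "v \<notin> P H" | "v \<notin> P H" "v \<notin> Q H"
      using disjoint[OF H] by blast
    then show "odd (card {u \<in> X - {v}. ?R H u}) \<longleftrightarrow>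
      (v \<in> P H \<and> odd (card (X \<inter> Q H))) \<or> (v \<in> Q H \<and> odd (card (X \<inter> P H)))"
    proof cases
      case 1
      then have "{u \<in> X - {v}. ?R H u} = X \<inter> Q H" by auto
      with 1 show ?thesis by simp
    next
      case 2
      then have "{u \<in> X - {v}. ?R H u} = X \<inter> P H" by auto
      with 2 show ?thesis by simp
    next
      case 3
      then have "{u \<in> X - {v}. ?R H u} = {}" by auto
      with 3 show ?thesis by simp
    qed
  qed
  finally show ?thesis .
qed

text \<open>All parities in \<open>odd_degree\<close> vanish, so \<open>X - {v}\<close> is even for
  every \<open>v\<close> in \<open>V\<close>. A \<open>v\<close> inside \<open>X\<close> makes
  \<open>card X\<close> odd, and a \<open>v\<close> outside would make it even.\<close>

lemma trivial_signature:
  assumes X: "X \<subseteq> V" "X \<noteq> {}" and sig: "signature X = ({}, {})"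
  shows "X = V" "odd (card X)"
proof -
  have even: "even (card (X - {v}))" if "v \<in> V" for v
  proof -
    have "{H \<in> F. (v \<in> P H \<and> odd (card (X \<inter> Q H))) \<or> (v \<in> Q H \<and> odd (card (X \<inter> P H)))} = {}"
      using sig unfolding signature_def by auto
    then show ?thesis
      using odd_degree[OF X(1) that] by (simp only: card.empty) simp
  qed
  have fX: "finite X" using finite_sub X(1) .
  obtain x where x: "x \<in> X" using X(2) by blast
  have "card X > 0" using x fX by (auto simp: card_gt_0_iff)
  then show odd: "odd (card X)"
    using even[of x] x X(1) fX by (auto simp: card_Diff_singleton)
  show "X = V"
  proof (rule ccontr)
    assume "X \<noteq> V"
    then obtain v where "v \<in> V" "v \<notin> X" using X(1) by blast
    with even[of v] odd show False by simp
  qed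
qed

text \<open>By additivity the symmetric difference \<open>D\<close> has trivial signature. If
  nonempty, it is all of \<open>V\<close> and odd, which either parity assumption excludes.\<close>

lemma signature_eqD:
  assumes X: "X \<subseteq> V" "Y \<subseteq> V" and sig: "signature X = signature Y"
    and par: "even (card V) \<or> (even (card X) \<and> even (card Y))"
  shows "X = Y"
proof (rule ccontr)
  assume "X \<noteq> Y"
  define D where "D = (X - Y) \<union> (Y - X)"
  have fin: "finite X" "finite Y" using X finite_sub by auto
  note parity = odd_card_sym_diff_Int[OF fin, folded D_def]
  have D: "D \<subseteq> V" "D \<noteq> {}" using X \<open>X \<noteq> Y\<close> by (auto simp: D_def)
  have "signature D = ({}, {})"
    using sig unfolding signature_def parity by auto
  note this = trivial_signature[OF D this]
  \<comment> \<open>With \<open>UNIV\<close> as the test set, additivity speaks of the cardinalities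
    themselves.\<close>
  moreover have "even (card D)" if "even (card X)" "even (card Y)"
    using parity[of UNIV] that by simp
  ultimately show False using par by auto
qed

lemma card_signature_space: "card (Pow F \<times> Pow F) = 2 ^ (2 * card F)"
  using finite_F by (simp add: card_cartesian_product card_Pow mult_2 power_add)

lemma signature_in: "signature X \<in> Pow F \<times> Pow F"
  by (auto simp: signature_def)

lemma even_order_bound:
  assumes "even (card V)"
  shows "card V \<le> 2 * card F"
proof -
  have "inj_on signature (Pow V)"
    using signature_eqD assms by (auto intro!: inj_onI)
  then have "card (Pow V) \<le> card (Pow F \<times> Pow F)"
    using finite_F signature_in by (intro card_inj_on_le[of signature]) blast+
  then show ?thesis
    unfolding card_signature_space using finite_V by (simp add: card_Pow)
qed

text \<open>If the bound below failed, every signature would belong to an even set. An even set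
  \<open>X\<close> with signature \<open>({H}, {})\<close> equals \<open>Q H\<close>, yet meets \<open>P H\<close> in an odd number of points.\<close>

lemma odd_order_bound:
  assumes odd: "odd (card V)" and large: "card V \<ge> 2"
  shows "card V + 1 \<le> 2 * card F"
proof (rule ccontr)
  assume neg: "\<not> ?thesis"
  from large obtain w where w: "w \<in> V" by fastforce
  \<comment> \<open>Toggling \<open>w\<close> repairs parity, so the subsets of
    \<open>V - {w}\<close> parametrize the even subsets of \<open>V\<close>.\<close>
  define E where "E X = (if even (card X) then X else insert w X)" for X
  have E: "E X \<subseteq> V" "even (card (E X))" if "X \<subseteq> V - {w}" for X
  proof -
    have "finite X" using that finite_sub by blast
    moreover have "w \<notin> X" using that by blast
    ultimately show "E X \<subseteq> V" "even (card (E X))" using that w by (auto simp: E_def)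
  qed
  have E_diff: "E X - {w} = X" if "X \<subseteq> V - {w}" for X
    using that by (auto simp: E_def)
  have inj: "inj_on (\<lambda>X. signature (E X)) (Pow (V - {w}))"
  proof (rule inj_onI)
    fix X Y assume XY: "X \<in> Pow (V - {w})" "Y \<in> Pow (V - {w})"
      and "signature (E X) = signature (E Y)"
    then have "E X = E Y" using E by (intro signature_eqD) auto
    then show "X = Y" using E_diff XY by (metis PowD)
  qed
  have "card ((\<lambda>X. signature (E X)) ` Pow (V - {w})) = 2 ^ (card V - 1)"
    using card_image[OF inj] w finite_V by (simp add: card_Pow)
  \<comment> \<open>Failure of the bound means \<open>2 * card F \<le> card V\<close>; as
    \<open>card V\<close> is odd, even \<open>card V - 1\<close> is enough. The injection is then
    onto.\<close>
  moreover have "2 ^ (card V - 1) \<ge> (2 ^ (2 * card F) :: nat)"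
    using neg odd by (intro power_increasing) (presburger | simp)+
  ultimately have "(\<lambda>X. signature (E X)) ` Pow (V - {w}) = Pow F \<times> Pow F"
    using finite_F signature_in card_signature_space
    by (intro card_seteq) (blast | simp)+
  moreover have "F \<noteq> {}"
  proof
    assume "F = {}"
    moreover have "\<not> card V \<le> Suc 0" using large by simp
    then obtain u v where "u \<in> V" "v \<in> V" "u \<noteq> v"
      unfolding card_le_Suc0_iff_eq[OF finite_V] by blast
    ultimately show False using cover[of u v] by simp
  qed
  then obtain H where H: "H \<in> F" by blast
  ultimately have "({H}, {}) \<in> (\<lambda>X. signature (E X)) ` Pow (V - {w})" by simp
  then obtain X0 where X0: "({H}, {}) = signature (E X0)" "X0 \<subseteq> V - {w}"
    by (elim imageE) simp
  define X where "X = E X0"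
  have X: "X \<subseteq> V" "even (card X)" using E[OF X0(2)] by (auto simp: X_def)
  have fX: "finite X" using finite_sub X(1) .
  have "{G \<in> F. odd (card (X \<inter> P G))} = {H}" "{G \<in> F. odd (card (X \<inter> Q G))} = {}"
    using X0(1) unfolding X_def signature_def by simp_all
  then have sig: "odd (card (X \<inter> P G)) \<longleftrightarrow> G = H" "even (card (X \<inter> Q G))" if "G \<in> F" for G
    using that by blast+
  \<comment> \<open>Only \<open>H\<close> can contribute to \<open>odd_degree\<close>, and only for
    \<open>v\<close> in \<open>Q H\<close>; as \<open>X\<close> is even, \<open>X - {v}\<close> is
    odd exactly for \<open>v\<close> in \<open>X\<close>.\<close>
  have "v \<in> X \<longleftrightarrow> v \<in> Q H" if v: "v \<in> V" for v
  proof -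
    have "{G \<in> F. (v \<in> P G \<and> odd (card (X \<inter> Q G))) \<or> (v \<in> Q G \<and> odd (card (X \<inter> P G)))} =
        (if v \<in> Q H then {H} else {})"
      using sig H by auto
    then have "odd (card (X - {v})) \<longleftrightarrow> v \<in> Q H"
      using odd_degree[OF X(1) v] by (simp only:) simp
    moreover have "odd (card (X - {v})) \<longleftrightarrow> v \<in> X"
    proof (cases "v \<in> X")
      case True
      then have "card X > 0" using fX by (auto simp: card_gt_0_iff)
      with True X(2) show ?thesis by (simp add: card_Diff_singleton)
    qed (use X(2) in simp)
    ultimately show ?thesis by simp
  qed
  then have "X \<inter> P H = {}" using X(1) disjoint[OF H] by blast
  moreover have "odd (card (X \<inter> P H))" using sig(1) H by simp
  ultimately show False by simp
qed

end

text \<open>If the last vertex \<open>m\<close> lies in a part, \<open>{u, v, m}\<close> is an edge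
  exactly when \<open>u\<close> and \<open>v\<close> represent the other two parts. If it lies in
  none, two vertices cannot meet three disjoint parts, so the biclique is empty.\<close>

lemma odd_cover_link:
  assumes F: "odd_cover (Suc m) F"
  obtains P Q where "biclique_cover {..<m} F P Q"
proof -
  define link where "link H PQ \<longleftrightarrow> fst PQ \<inter> snd PQ = {} \<and>
    (\<forall>u<m. \<forall>v<m. u \<noteq> v \<longrightarrow> {u, v, m} \<in> H \<longleftrightarrow>
      (u \<in> fst PQ \<and> v \<in> snd PQ) \<or> (v \<in> fst PQ \<and> u \<in> snd PQ))" for H PQ
  have "\<exists>PQ. link H PQ" if "H \<in> F" for H
  proof -
    from F that have "complete_tripartite (Suc m) H" by (simp add: odd_cover_def)
    then obtain A B C where d: "A \<inter> B = {}" "A \<inter> C = {}" "B \<inter> C = {}"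
      and H: "H = tripartite_edges (Suc m) A B C"
      by (auto simp only: complete_tripartite_def)
    have mem: "{u, v, m} \<in> H \<longleftrightarrow>
        {u, v, m} \<inter> A \<noteq> {} \<and> {u, v, m} \<inter> B \<noteq> {} \<and> {u, v, m} \<inter> C \<noteq> {}"
      if "u < m" "v < m" "u \<noteq> v" for u v
      unfolding H using that by (intro triple_in_tripartite_edges_iff) auto
    consider "m \<in> A" | "m \<in> B" | "m \<in> C" | "m \<notin> A \<union> B \<union> C" by blast
    then show ?thesis
    proof cases
      case 1
      then have "link H (B, C)" using d unfolding link_def by (auto simp: mem)
      then show ?thesis ..
    next
      case 2
      then have "link H (A, C)" using d unfolding link_def by (auto simp: mem)
      then show ?thesis ..
    next
      case 3
      then have "link H (A, B)" using d unfolding link_def by (auto simp: mem)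
      then show ?thesis ..
    next
      case 4
      then have "link H ({}, {})" using d unfolding link_def by (auto simp: mem)
      then show ?thesis ..
    qed
  qed
  then obtain f where f: "link H (f H)" if "H \<in> F" for H by metis
  have "biclique_cover {..<m} F (\<lambda>H. fst (f H)) (\<lambda>H. snd (f H))"
  proof
    show "finite F" using odd_cover_finite[OF F] .
  next
    fix u v assume uv: "u \<in> {..<m}" "v \<in> {..<m}" "u \<noteq> v"
    then have "{u, v, m} \<in> K3 (Suc m)" by (auto simp: K3_def)
    then have "odd (card {H \<in> F. {u, v, m} \<in> H})" using F by (simp add: odd_cover_def)
    moreover have "{H \<in> F. {u, v, m} \<in> H} = {H \<in> F. (u \<in> fst (f H) \<and> v \<in> snd (f H)) \<or>
        (v \<in> fst (f H) \<and> u \<in> snd (f H))}"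
      using f uv unfolding link_def by blast
    ultimately show "odd (card {H \<in> F. (u \<in> fst (f H) \<and> v \<in> snd (f H)) \<or>
        (v \<in> fst (f H) \<and> u \<in> snd (f H))})" by simp
  qed (use f in \<open>auto simp: link_def\<close>)
  then show thesis by (rule that)
qed

text \<open>With \<open>n = m + 1\<close>, the bounds are \<open>m / 2\<close> for even
  \<open>m\<close> and \<open>(m + 1) / 2\<close> for odd \<open>m\<close>, which is
  \<open>n div 2\<close> in both cases.\<close>

lemma b3_lower:
  assumes "n \<ge> 3"
  shows "n div 2 \<le> b3 n"
proof -
  have "\<exists>k F. odd_cover n F \<and> card F = k" using odd_cover_exists[of n] by blast
  from LeastI_ex[OF this] obtain F where F: "odd_cover n F" "card F = b3 n"
    unfolding b3_def by blast
  obtain m where m: "n = Suc m" using assms by (cases n) auto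
  obtain P Q where "biclique_cover {..<m} F P Q"
    using odd_cover_link F(1) unfolding m by blast
  then interpret biclique_cover "{..<m}" F P Q .
  show ?thesis
  proof (cases "even m")
    case True
    then show ?thesis using even_order_bound F(2) m by simp
  next
    case False
    then show ?thesis using odd_order_bound assms F(2) m by simp
  qed
qed

section \<open>Covers from colourings\<close>

text \<open>Constructions yield lists with possible repetitions, but a cover is a set. Keeping the
  graphs of odd multiplicity preserves all parities.\<close>

lemma odd_multiplicity_family:
  "\<exists>F. F \<subseteq> set Hs \<and> card F \<le> length Hs \<and>
    (\<forall>e. odd (card {H \<in> F. e \<in> H}) \<longleftrightarrow> odd (length (filter (\<lambda>H. e \<in> H) Hs)))"
proof (induction Hs)
  case Nil
  show ?case by simp
next
  case (Cons G Hs)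
  then obtain F where F: "F \<subseteq> set Hs" "card F \<le> length Hs"
    "\<And>e. odd (card {H \<in> F. e \<in> H}) \<longleftrightarrow> odd (length (filter (\<lambda>H. e \<in> H) Hs))" by blast
  have fin: "finite F" using F(1) finite_subset by blast
  \<comment> \<open>One more copy of \<open>G\<close> toggles its membership.\<close>
  define F' where "F' = (if G \<in> F then F - {G} else insert G F)"
  have "F' \<subseteq> set (G # Hs)" using F(1) by (auto simp: F'_def)
  moreover have "card F' \<le> length (G # Hs)"
    using F(2) fin by (auto simp: F'_def card_insert_if intro: le_trans[OF card_Diff1_le])
  moreover have "odd (card {H \<in> F'. e \<in> H}) \<longleftrightarrow> odd (length (filter (\<lambda>H. e \<in> H) (G # Hs)))" for e
  proof (cases "e \<in> G")
    case False
    then have "{H \<in> F'. e \<in> H} = {H \<in> F. e \<in> H}" by (auto simp: F'_def)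
    with False F(3) show ?thesis by simp
  next
    case eG: True
    show ?thesis
    proof (cases "G \<in> F")
      case True
      then have "{H \<in> F. e \<in> H} = insert G {H \<in> F'. e \<in> H}" "G \<notin> F'"
        using eG by (auto simp: F'_def)
      then have "card {H \<in> F. e \<in> H} = Suc (card {H \<in> F'. e \<in> H})"
        using fin by (simp add: F'_def)
      with F(3)[of e] eG show ?thesis by simp
    next
      case False
      then have "{H \<in> F'. e \<in> H} = insert G {H \<in> F. e \<in> H}"
        using eG by (auto simp: F'_def)
      then have "card {H \<in> F'. e \<in> H} = Suc (card {H \<in> F. e \<in> H})"
        using fin False by simp
      with F(3)[of e] eG show ?thesis by simp
    qed
  qed
  ultimately show ?case by blast
qed

abbreviation odd_many :: "('a \<Rightarrow> bool) \<Rightarrow> 'a list \<Rightarrow> bool" where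
  "odd_many R xs \<equiv> odd (length (filter R xs))"

definition rainbow :: "nat \<Rightarrow> nat \<Rightarrow> nat \<Rightarrow> bool" where
  "rainbow a b c \<longleftrightarrow> a \<noteq> b \<and> a \<noteq> c \<and> b \<noteq> c"

lemma less_3_cases: "a < 3 \<Longrightarrow> a = 0 \<or> a = 1 \<or> a = (2 :: nat)"
  by auto

lemma rainbow_iff_all_colours:
  assumes "a < 3" "b < 3" "c < 3"
  shows "rainbow a b c \<longleftrightarrow> 0 \<in> {a, b, c} \<and> 1 \<in> {a, b, c} \<and> 2 \<in> {a, b, c}"
  using assms[THEN less_3_cases] by (elim disjE; simp add: rainbow_def)

text \<open>The colour classes are the three parts, so the edges are the rainbow triples.\<close>

lemma b3_le_colourings:
  assumes col: "\<And>\<phi> x. \<phi> \<in> set \<phi>s \<Longrightarrow> \<phi> x < 3"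
    and odd: "\<And>x y z. x < y \<Longrightarrow> y < z \<Longrightarrow> z < n \<Longrightarrow> odd_many (\<lambda>\<phi>. rainbow (\<phi> x) (\<phi> y) (\<phi> z)) \<phi>s"
  shows "b3 n \<le> length \<phi>s"
proof -
  define T where "T \<phi> = tripartite_edges n {x. x < n \<and> \<phi> x = 0} {x. x < n \<and> \<phi> x = 1}
    {x. x < n \<and> \<phi> x = 2}" for \<phi> :: "nat \<Rightarrow> nat"
  have tri: "complete_tripartite n (T \<phi>)" for \<phi>
    unfolding complete_tripartite_def T_def
    by (intro exI[of _ "{x. x < n \<and> \<phi> x = 0}"] exI[of _ "{x. x < n \<and> \<phi> x = 1}"]
        exI[of _ "{x. x < n \<and> \<phi> x = 2}"]) auto
  obtain F where F: "F \<subseteq> set (map T \<phi>s)" "card F \<le> length \<phi>s"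
    "\<And>e. odd (card {H \<in> F. e \<in> H}) \<longleftrightarrow> odd_many (\<lambda>H. e \<in> H) (map T \<phi>s)"
    using odd_multiplicity_family[of "map T \<phi>s"] by auto
  have "odd_cover n F"
    unfolding odd_cover_def
  proof (intro conjI ballI)
    fix H assume "H \<in> F"
    then show "complete_tripartite n H" using F(1) tri by auto
  next
    fix e assume "e \<in> K3 n"
    then have e: "e \<subseteq> {..<n}" "card e = 3" by (auto simp: K3_def)
    then have "\<exists>x y z. e = {x, y, z} \<and> x < y \<and> y < z"
    proof -
      have fin: "finite e" using e(2) by (simp add: card_ge_0_finite)
      obtain xs where xs: "set xs = e" "sorted_wrt (<) xs" "length xs = 3"
        using e(2) fin strict_sorted_list_of_set by (metis set_sorted_list_of_set length_sorted_list_of_set)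
      moreover obtain x y z where "xs = [x, y, z]"
        using xs(3) by (auto simp: length_Suc_conv numeral_3_eq_3)
      ultimately show ?thesis by auto
    qed
    then obtain x y z where xyz: "e = {x, y, z}" "x < y" "y < z" by blast
    then have z: "z < n" using e(1) by simp
    have "e \<in> T \<phi> \<longleftrightarrow> rainbow (\<phi> x) (\<phi> y) (\<phi> z)" if "\<phi> \<in> set \<phi>s" for \<phi>
    proof -
      have colour_class: "e \<inter> {v. v < n \<and> \<phi> v = i} \<noteq> {} \<longleftrightarrow> i \<in> {\<phi> x, \<phi> y, \<phi> z}" for i
        using xyz z by auto
      have "e \<in> K3 n" by fact
      then show ?thesis
        using rainbow_iff_all_colours[OF col[OF that] col[OF that] col[OF that]]
        by (simp only: T_def tripartite_edges_def mem_Collect_eq colour_class simp_thms)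
    qed
    then have "filter (\<lambda>\<phi>. e \<in> T \<phi>) \<phi>s = filter (\<lambda>\<phi>. rainbow (\<phi> x) (\<phi> y) (\<phi> z)) \<phi>s"
      by (intro filter_cong) auto
    then show "odd (card {H \<in> F. e \<in> H})"
      unfolding F(3) filter_map o_def length_map using odd[OF xyz(2,3) z] by simp
  qed
  then have "b3 n \<le> card F" unfolding b3_def by (intro Least_le) auto
  with F(2) show ?thesis by simp
qed

text \<open>Parity is additive under exclusive or, so counts below are found by splitting a
  predicate into single points and constants.\<close>

lemma odd_many_xor:
  "odd_many (\<lambda>x. R x \<noteq> S x) xs \<longleftrightarrow> odd_many R xs \<noteq> odd_many S xs"
  by (induction xs) auto

lemma odd_many_point:
  assumes "p < m"
  shows "odd_many (\<lambda>i. i = p \<and> c) [0..<m] \<longleftrightarrow> c"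
proof -
  have "filter (\<lambda>i. i = p) [0..<m] = [p]"
    using assms by (induction m) (auto simp: less_Suc_eq intro!: filter_False)
  then show ?thesis by (cases c) simp_all
qed

lemma odd_many_const: "odd_many (\<lambda>i. c) [0..<m] \<longleftrightarrow> odd m \<and> c"
  by (cases c) simp_all

section \<open>Covers from tournaments\<close>

lemma div_2_eq_parity: "x div 2 = y div 2 \<Longrightarrow> x \<noteq> y \<Longrightarrow> odd x \<noteq> odd (y :: nat)"
  by presburger

lemma rainbow_of_bool:
  "rainbow 2 (of_bool a) (of_bool b) \<longleftrightarrow> a \<noteq> b"
  "rainbow (of_bool a) 2 (of_bool b) \<longleftrightarrow> a \<noteq> b"
  "rainbow (of_bool a) (of_bool b) 2 \<longleftrightarrow> a \<noteq> b"
  "\<not> rainbow (of_bool a) (of_bool b) (of_bool c)"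
  "\<not> rainbow d d e" "\<not> rainbow d e d" "\<not> rainbow e d d"
  by (cases a; cases b; cases c; simp add: rainbow_def)+

text \<open>Pair \<open>j\<close> is \<open>{2 * j, 2 * j + 1}\<close>. Colour 2 marks pair
  \<open>i\<close> and the possible extra vertex \<open>2 * m\<close>; \<open>t i j\<close> swaps
  colours 0 and 1 on pair \<open>j\<close>.\<close>

definition tournament_colour :: "(nat \<Rightarrow> nat \<Rightarrow> bool) \<Rightarrow> nat \<Rightarrow> nat \<Rightarrow> nat \<Rightarrow> nat" where
  "tournament_colour t m i x =
    (if x div 2 = i \<or> x = 2 * m then 2 else of_bool (odd x \<noteq> t i (x div 2)))"

context
  fixes t :: "nat \<Rightarrow> nat \<Rightarrow> bool" and m :: nat
  assumes tournament: "i \<noteq> j \<Longrightarrow> t i j \<noteq> t j i"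
begin

text \<open>Two vertices of one pair need the third in colour 2, which singles out one graph. For
  three pairs only the graphs \<open>p\<close>, \<open>q\<close>, \<open>r\<close> matter: modulo 2
  each vertex parity occurs twice and cancels, and the three sums \<open>t i j + t j i\<close> leave
  1.\<close>

lemma tournament_triple:
  assumes "x < y" "y < z" "z < 2 * m"
  shows "odd_many (\<lambda>i. rainbow (tournament_colour t m i x) (tournament_colour t m i y)
    (tournament_colour t m i z)) [0..<m]"
proof -
  define p q r where pqr: "p = x div 2" "q = y div 2" "r = z div 2"
  have lt: "p < m" "q < m" "r < m" using assms by (auto simp: pqr)
  have ne: "x \<noteq> 2 * m" "y \<noteq> 2 * m" "z \<noteq> 2 * m" using assms by auto
  have xy: "p = q \<Longrightarrow> odd x \<noteq> odd y" and yz: "q = r \<Longrightarrow> odd y \<noteq> odd z"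
    using div_2_eq_parity[of x y] div_2_eq_parity[of y z] assms by (auto simp: pqr)
  \<comment> \<open>Since \<open>y\<close> lies strictly between, \<open>z\<close> is at least
    \<open>x + 2\<close>.\<close>
  have "p \<noteq> r" using assms unfolding pqr by linarith
  have colour: "tournament_colour t m i x = (if p = i then 2 else of_bool (odd x \<noteq> t i p))"
      "tournament_colour t m i y = (if q = i then 2 else of_bool (odd y \<noteq> t i q))"
      "tournament_colour t m i z = (if r = i then 2 else of_bool (odd z \<noteq> t i r))" for i
    using ne by (simp_all add: tournament_colour_def pqr)
  consider "p = q" | "q = r" | "p \<noteq> q" "q \<noteq> r" by blast
  then show ?thesis
  proof cases
    case 1
    then have "(\<lambda>i. rainbow (tournament_colour t m i x) (tournament_colour t m i y)
        (tournament_colour t m i z)) = (\<lambda>i. i = r \<and> True)"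
      using xy \<open>p \<noteq> r\<close> by (auto simp: fun_eq_iff colour rainbow_of_bool)
    then show ?thesis using odd_many_point[OF lt(3), of True] by (simp only:)
  next
    case 2
    then have "(\<lambda>i. rainbow (tournament_colour t m i x) (tournament_colour t m i y)
        (tournament_colour t m i z)) = (\<lambda>i. i = p \<and> True)"
      using yz \<open>p \<noteq> r\<close> by (auto simp: fun_eq_iff colour rainbow_of_bool)
    then show ?thesis using odd_many_point[OF lt(1), of True] by (simp only:)
  next
    case 3
    have eq: "(\<lambda>i. rainbow (tournament_colour t m i x) (tournament_colour t m i y)
        (tournament_colour t m i z)) =
      (\<lambda>i. (i = p \<and> ((odd y \<noteq> t p q) \<noteq> (odd z \<noteq> t p r))) \<noteq>
        ((i = q \<and> ((odd x \<noteq> t q p) \<noteq> (odd z \<noteq> t q r))) \<noteq>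
         (i = r \<and> ((odd x \<noteq> t r p) \<noteq> (odd y \<noteq> t r q)))))" (is "?L = ?R")
    proof
      fix i
      consider "i = p" | "i = q" | "i = r" | "p \<noteq> i" "q \<noteq> i" "r \<noteq> i" by blast
      then show "?L i \<longleftrightarrow> ?R i"
        using 3 \<open>p \<noteq> r\<close> by cases (simp_all add: colour rainbow_of_bool)
    qed
    show ?thesis
      unfolding eq odd_many_xor odd_many_point[OF lt(1)] odd_many_point[OF lt(2)]
        odd_many_point[OF lt(3)]
      using tournament[OF 3(1)] tournament[OF 3(2)] tournament[OF \<open>p \<noteq> r\<close>]
      by (cases "odd x"; cases "odd y"; cases "odd z") auto
  qed
qed

text \<open>The apex always has colour 2, so \<open>x\<close> and \<open>y\<close> must get colours
  0 and 1. Vertices of one pair do so in all \<open>m - 1\<close> graphs other than their own, an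
  odd number.\<close>

lemma tournament_triple_apex:
  assumes "x < y" "y < 2 * m" and "even m"
    and in_degree: "\<And>j. j < m \<Longrightarrow> \<not> odd_many (\<lambda>i. i \<noteq> j \<and> t i j) [0..<m]"
  shows "odd_many (\<lambda>i. rainbow (tournament_colour t m i x) (tournament_colour t m i y)
    (tournament_colour t m i (2 * m))) [0..<m]"
proof -
  define p q where pq: "p = x div 2" "q = y div 2"
  have lt: "p < m" "q < m" using assms by (auto simp: pq)
  have ne: "x \<noteq> 2 * m" "y \<noteq> 2 * m" using assms by auto
  have xy: "p = q \<Longrightarrow> odd x \<noteq> odd y" using div_2_eq_parity[of x y] assms by (simp add: pq)
  have colour: "tournament_colour t m i x = (if p = i then 2 else of_bool (odd x \<noteq> t i p))"
      "tournament_colour t m i y = (if q = i then 2 else of_bool (odd y \<noteq> t i q))"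
      "tournament_colour t m i (2 * m) = 2" for i
    using ne by (simp_all add: tournament_colour_def pq)
  show ?thesis
  proof (cases "p = q")
    case True
    then have "(\<lambda>i. rainbow (tournament_colour t m i x) (tournament_colour t m i y)
        (tournament_colour t m i (2 * m))) = (\<lambda>i. True \<noteq> (i = p \<and> True))"
      using xy by (auto simp: fun_eq_iff colour rainbow_of_bool)
    then show ?thesis
      using \<open>even m\<close> by (simp only: odd_many_xor odd_many_point odd_many_const lt) simp
  next
    case False
    define b where "b \<longleftrightarrow> odd x \<noteq> odd y"
    \<comment> \<open>For \<open>i\<close> other than \<open>p\<close>, \<open>q\<close> the value
      is \<open>b + t i p + t i q\<close>. Over all \<open>i\<close> the \<open>b\<close> terms and
      the in-degrees are even; removing the arcs between \<open>p\<close> and \<open>q\<close>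
      leaves \<open>t q p + t p q = 1\<close>.\<close>
    have eq: "(\<lambda>i. rainbow (tournament_colour t m i x) (tournament_colour t m i y)
        (tournament_colour t m i (2 * m))) =
      (\<lambda>i. b \<noteq> ((i = p \<and> b) \<noteq> ((i = q \<and> b) \<noteq> ((i \<noteq> p \<and> t i p) \<noteq>
        ((i = q \<and> t q p) \<noteq> ((i \<noteq> q \<and> t i q) \<noteq> (i = p \<and> t p q)))))))" (is "?L = ?R")
    proof
      fix i
      consider "i = p" | "i = q" | "p \<noteq> i" "q \<noteq> i" by blast
      then show "?L i \<longleftrightarrow> ?R i"
        using False by cases (auto simp: colour rainbow_of_bool b_def)
    qed
    show ?thesis
      unfolding eq odd_many_xor odd_many_point[OF lt(1)] odd_many_point[OF lt(2)] odd_many_const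
      using \<open>even m\<close> in_degree[OF lt(1)] in_degree[OF lt(2)] tournament[OF False]
      by (cases b) simp_all
  qed
qed

end

lemma odd_mod_4: "odd i \<Longrightarrow> i mod 4 = 1 \<or> i mod 4 = (3 :: nat)"
  by presburger

lemma b3_le_half:
  assumes "n \<le> 2 * m"
  shows "b3 n \<le> m"
proof -
  let ?\<phi>s = "map (tournament_colour (<) m) [0..<m]"
  have "b3 n \<le> length ?\<phi>s"
  proof (rule b3_le_colourings)
    fix x y z :: nat assume "x < y" "y < z" "z < n"
    then show "odd_many (\<lambda>\<phi>. rainbow (\<phi> x) (\<phi> y) (\<phi> z)) ?\<phi>s"
      unfolding filter_map o_def length_map using assms by (intro tournament_triple) auto
  qed (auto simp: tournament_colour_def)
  then show ?thesis by simp
qed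

text \<open>In the transitive tournament \<open>j\<close> has in-degree \<open>j\<close>; reversing the arcs between
  \<open>4 * k + 1\<close> and \<open>4 * k + 3\<close> makes all in-degrees even.\<close>

lemma b3_le_mod_8:
  assumes "n mod 8 = 1"
  shows "b3 n \<le> (n - 1) div 2"
proof -
  define m where "m = (n - 1) div 2"
  have m: "n = 2 * m + 1" "m mod 4 = 0" using assms unfolding m_def by presburger+
  define t :: "nat \<Rightarrow> nat \<Rightarrow> bool" where
    "t i j \<longleftrightarrow> (i < j) \<noteq> (i div 4 = j div 4 \<and> odd i \<and> odd j)" for i j
  have tour: "t i j \<noteq> t j i" if "i \<noteq> j" for i j
    using that unfolding t_def by auto
  have deg: "\<not> odd_many (\<lambda>i. i \<noteq> j \<and> t i j) [0..<m]" if j: "j < m" for j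
  proof -
    have below: "odd_many (\<lambda>i. i < j) [0..<m] \<longleftrightarrow> odd j"
    proof -
      have "filter (\<lambda>i. i < j) ([0..<j] @ [j..<m]) = [0..<j]"
        by (simp add: filter_empty_conv)
      then have "filter (\<lambda>i. i < j) [0..<m] = [0..<j]"
        using upt_add_eq_append[of 0 j "m - j"] j by simp
      then show ?thesis by simp
    qed
    \<comment> \<open>For odd \<open>j\<close> this is the other odd number in its block of four,
      since \<open>r\<close> to \<open>4 - r\<close> swaps residues 1 and 3.\<close>
    define j' where "j' = 4 * (j div 4) + (4 - j mod 4)"
    have partner: "i \<noteq> j \<and> i div 4 = j div 4 \<and> odd i \<longleftrightarrow> i = j'" if odd_j: "odd j" for i
    proof
      assume i: "i \<noteq> j \<and> i div 4 = j div 4 \<and> odd i"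
      then have "i mod 4 \<noteq> j mod 4" by (metis div_mult_mod_eq)
      then have "i mod 4 = 4 - j mod 4" using odd_mod_4[of i] odd_mod_4[of j] i odd_j by auto
      then show "i = j'" using i div_mult_mod_eq[of i 4] unfolding j'_def by simp
    next
      assume i: "i = j'"
      from odd_mod_4[OF odd_j] show "i \<noteq> j \<and> i div 4 = j div 4 \<and> odd i"
      proof
        assume r: "j mod 4 = 1"
        then have "i mod 4 = 3" "i div 4 = j div 4" "odd i" by (simp_all add: i j'_def)
        with r show ?thesis by auto
      next
        assume r: "j mod 4 = 3"
        then have "i mod 4 = 1" "i div 4 = j div 4" "odd i" by (simp_all add: i j'_def)
        with r show ?thesis by auto
      qed
    qed
    \<comment> \<open>As 4 divides \<open>m\<close>, the whole block of \<open>j\<close> lies below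
      \<open>m\<close>.\<close>
    have "j' < m" if "odd j"
    proof -
      have "j div 4 < m div 4" using j m(2) by presburger
      moreover have "j mod 4 > 0" using that by presburger
      moreover have "m = 4 * (m div 4)" using m(2) by auto
      ultimately show ?thesis unfolding j'_def by linarith
    qed
    then have reversed: "odd_many (\<lambda>i. i = j' \<and> odd j) [0..<m] \<longleftrightarrow> odd j"
      using odd_many_point[of j' m "odd j"] by (cases "odd j") simp_all
    have "(\<lambda>i. i \<noteq> j \<and> t i j) = (\<lambda>i. (i < j) \<noteq> (i = j' \<and> odd j))"
      using partner by (auto simp: fun_eq_iff t_def)
    then show ?thesis by (simp only: odd_many_xor below reversed)
  qed
  let ?\<phi>s = "map (tournament_colour t m) [0..<m]"
  have "b3 n \<le> length ?\<phi>s"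
  proof (rule b3_le_colourings)
    fix x y z :: nat assume xyz: "x < y" "y < z" "z < n"
    have "odd_many (\<lambda>i. rainbow (tournament_colour t m i x) (tournament_colour t m i y)
        (tournament_colour t m i z)) [0..<m]"
    proof (cases "z = 2 * m")
      case True
      have y: "y < 2 * m" using xyz(2) True by simp
      have m_even: "even m" using m(2) by presburger
      show ?thesis
        unfolding True
      proof (rule tournament_triple_apex[OF _ xyz(1) y m_even])
        show "t i j \<noteq> t j i" if "i \<noteq> j" for i j using tour[OF that] .
        show "\<not> odd_many (\<lambda>i. i \<noteq> j \<and> t i j) [0..<m]" if "j < m" for j using deg[OF that] .
      qed
    next
      case False
      then have "z < 2 * m" using xyz(3) m(1) by simp
      with tour xyz(1,2) show ?thesis by (rule tournament_triple)
    qed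
    then show "odd_many (\<lambda>\<phi>. rainbow (\<phi> x) (\<phi> y) (\<phi> z)) ?\<phi>s"
      unfolding filter_map o_def length_map .
  qed (auto simp: tournament_colour_def)
  then show ?thesis by (simp add: m_def)
qed

section \<open>Powers of three\<close>

text \<open>The pair condition strengthens the induction: triples with exactly two equal residues
  modulo 3 reduce to it.\<close>

definition odd_separating :: "nat \<Rightarrow> (nat \<Rightarrow> nat) list \<Rightarrow> bool" where
  "odd_separating n \<phi>s \<longleftrightarrow> (\<forall>\<phi>\<in>set \<phi>s. \<forall>x. \<phi> x < 3) \<and>
    (\<forall>x<n. \<forall>y<n. x \<noteq> y \<longrightarrow> odd_many (\<lambda>\<phi>. \<phi> x \<noteq> \<phi> y) \<phi>s) \<and>
    (\<forall>x<n. \<forall>y<n. \<forall>z<n. x \<noteq> y \<longrightarrow> x \<noteq> z \<longrightarrow> y \<noteq> z \<longrightarrow>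
      odd_many (\<lambda>\<phi>. rainbow (\<phi> x) (\<phi> y) (\<phi> z)) \<phi>s)"

text \<open>Here \<open>x mod 3\<close> is a new coordinate. The extensions of \<open>\<phi>\<close>
  by its multiples, together with the coordinate itself, give all functionals up to sign one
  dimension higher.\<close>

definition twists :: "(nat \<Rightarrow> nat) \<Rightarrow> (nat \<Rightarrow> nat) list" where
  "twists \<phi> = map (\<lambda>c x. (\<phi> (x div 3) + c * (x mod 3)) mod 3) [0, 1, 2]"

lemma odd_many_concat:
  assumes "\<And>x. x \<in> set xs \<Longrightarrow> odd_many R (f x) \<longleftrightarrow> S x"
  shows "odd_many R (concat (map f xs)) \<longleftrightarrow> odd_many S xs"
  using assms by (induction xs) auto

text \<open>For \<open>a \<noteq> b\<close> the difference takes each value modulo 3 once, so it is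
  nonzero twice; for \<open>a = b\<close> it is constant.\<close>

lemma odd_twists_pair:
  fixes p q a b :: nat
  assumes "p < 3" "q < 3" "a < 3" "b < 3"
  shows "odd_many (\<lambda>c. (p + c * a) mod 3 \<noteq> (q + c * b) mod 3) [0, 1, 2] \<longleftrightarrow> a = b \<and> p \<noteq> q"
  using assms[THEN less_3_cases] by (elim disjE; simp add: rainbow_def)

text \<open>Equal slopes give the same answer three times. If exactly two agree, the third value
  runs through all offsets relative to them and makes one rainbow when those two differ. For three
  slopes the sum modulo 3 is constant: if it is 0, one \<open>k\<close> gives equal values and two
  give rainbows; otherwise there is no rainbow.\<close>

lemma odd_twists_triple:
  fixes p q r a b c :: nat
  assumes "p < 3" "q < 3" "r < 3" "a < 3" "b < 3" "c < 3"
  shows "odd_many (\<lambda>k. rainbow ((p + k * a) mod 3) ((q + k * b) mod 3) ((r + k * c) mod 3)) [0, 1, 2] \<longleftrightarrow>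
    (if a = b then if a = c then rainbow p q r else p \<noteq> q
     else if a = c then p \<noteq> r else b = c \<and> q \<noteq> r)"
  using assms[THEN less_3_cases] by (elim disjE; simp add: rainbow_def)

text \<open>When all residues differ, the twists contribute evenly and the new colouring contributes
  1. Otherwise the new colouring contributes 0, except that it separates a pair with different
  residues, and equal residues lead back to distinct quotients.\<close>

lemma odd_separating_triple_step:
  assumes \<phi>s: "odd_separating n \<phi>s"
  shows "odd_separating (3 * n) ((\<lambda>x. x mod 3) # concat (map twists \<phi>s))"
    (is "odd_separating _ (?\<psi> # ?\<psi>s)")
proof -
  have lt3: "\<phi> x < 3" if "\<phi> \<in> set \<phi>s" for \<phi> x
    using \<phi>s that by (simp add: odd_separating_def)
  have sep: "odd_many (\<lambda>\<phi>. \<phi> x \<noteq> \<phi> y) \<phi>s" if "x < n" "y < n" "x \<noteq> y" for x y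
    using \<phi>s that by (simp add: odd_separating_def)
  have rb: "odd_many (\<lambda>\<phi>. rainbow (\<phi> x) (\<phi> y) (\<phi> z)) \<phi>s"
    if "x < n" "y < n" "z < n" "x \<noteq> y" "x \<noteq> z" "y \<noteq> z" for x y z
    using \<phi>s that by (simp add: odd_separating_def)
  have div: "x div 3 < n" if "x < 3 * n" for x :: nat using that by auto
  have neq: "x div 3 \<noteq> y div 3" if "x mod 3 = y mod 3" "x \<noteq> y" for x y :: nat
    using that div_mult_mod_eq[of x 3] div_mult_mod_eq[of y 3] by auto
  have pair: "odd_many (\<lambda>\<phi>. \<phi> x \<noteq> \<phi> y) (?\<psi> # ?\<psi>s)"
    if xy: "x < 3 * n" "y < 3 * n" "x \<noteq> y" for x y
  proof -
    have "odd_many (\<lambda>\<phi>. \<phi> x \<noteq> \<phi> y) ?\<psi>s \<longleftrightarrow>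
        odd_many (\<lambda>\<phi>. x mod 3 = y mod 3 \<and> \<phi> (x div 3) \<noteq> \<phi> (y div 3)) \<phi>s"
      by (intro odd_many_concat, unfold twists_def filter_map o_def length_map,
          rule odd_twists_pair) (auto intro: lt3)
    then show ?thesis
      using sep[OF div[OF xy(1)] div[OF xy(2)]] neq xy(3) by (cases "x mod 3 = y mod 3") auto
  qed
  have triple: "odd_many (\<lambda>\<phi>. rainbow (\<phi> x) (\<phi> y) (\<phi> z)) (?\<psi> # ?\<psi>s)"
    if xyz: "x < 3 * n" "y < 3 * n" "z < 3 * n" "x \<noteq> y" "x \<noteq> z" "y \<noteq> z" for x y z
  proof -
    let ?S = "\<lambda>\<phi>. if x mod 3 = y mod 3 then
        if x mod 3 = z mod 3 then rainbow (\<phi> (x div 3)) (\<phi> (y div 3)) (\<phi> (z div 3))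
        else \<phi> (x div 3) \<noteq> \<phi> (y div 3)
      else if x mod 3 = z mod 3 then \<phi> (x div 3) \<noteq> \<phi> (z div 3)
      else y mod 3 = z mod 3 \<and> \<phi> (y div 3) \<noteq> \<phi> (z div 3)"
    have cat: "odd_many (\<lambda>\<phi>. rainbow (\<phi> x) (\<phi> y) (\<phi> z)) ?\<psi>s \<longleftrightarrow> odd_many ?S \<phi>s"
      by (intro odd_many_concat, unfold twists_def filter_map o_def length_map,
          rule odd_twists_triple) (auto intro: lt3)
    note d = div[OF xyz(1)] div[OF xyz(2)] div[OF xyz(3)]
    show ?thesis
    proof (cases "x mod 3 = y mod 3")
      case xy: True
      show ?thesis
      proof (cases "x mod 3 = z mod 3")
        case xz: True
        have "y mod 3 = z mod 3" using xy xz by (rule subst)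
        note rb[OF d neq[OF xy xyz(4)] neq[OF xz xyz(5)] neq[OF this xyz(6)]]
        then show ?thesis using cat xy xz by (simp add: rainbow_def)
      next
        case False
        with sep[OF d(1,2) neq[OF xy xyz(4)]] cat xy show ?thesis by (simp add: rainbow_def)
      qed
    next
      case nxy: False
      show ?thesis
      proof (cases "x mod 3 = z mod 3")
        case xz: True
        with sep[OF d(1,3) neq[OF xz xyz(5)]] cat nxy show ?thesis by (simp add: rainbow_def)
      next
        case nxz: False
        show ?thesis
        proof (cases "y mod 3 = z mod 3")
          case yz: True
          with sep[OF d(2,3) neq[OF yz xyz(6)]] cat nxy nxz show ?thesis
            by (simp add: rainbow_def)
        next
          case False
          with cat nxy nxz show ?thesis by (simp add: rainbow_def)
        qed
      qed
    qed
  qed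
  have "\<forall>\<phi>\<in>set (?\<psi> # ?\<psi>s). \<forall>x. \<phi> x < 3" by (auto simp: twists_def)
  with pair triple show ?thesis unfolding odd_separating_def by blast
qed

text \<open>A step turns length \<open>l\<close> into \<open>3 * l + 1\<close>, which triples
  \<open>2 * l + 1\<close>; a single vertex needs no colouring.\<close>

lemma odd_separating_power_3: "\<exists>\<phi>s. odd_separating (3 ^ k) \<phi>s \<and> 2 * length \<phi>s + 1 = 3 ^ k"
proof (induction k)
  case 0
  have "odd_separating (3 ^ 0) []" by (simp add: odd_separating_def)
  then show ?case by fastforce
next
  case (Suc k)
  then obtain \<phi>s where \<phi>s: "odd_separating (3 ^ k) \<phi>s" "2 * length \<phi>s + 1 = 3 ^ k" by blast
  have "length (concat (map twists \<phi>s)) = 3 * length \<phi>s"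
    by (induction \<phi>s) (simp_all add: twists_def)
  then have "2 * length ((\<lambda>x. x mod 3) # concat (map twists \<phi>s)) + 1 = 3 ^ Suc k"
    using \<phi>s(2) by simp
  then show ?case using odd_separating_triple_step[OF \<phi>s(1)] by (metis power_Suc)
qed

lemma b3_le_power_3: "b3 (3 ^ k) \<le> (3 ^ k - 1) div 2"
proof -
  obtain \<phi>s where \<phi>s: "odd_separating (3 ^ k) \<phi>s" "2 * length \<phi>s + 1 = 3 ^ k"
    using odd_separating_power_3 by blast
  have "b3 (3 ^ k) \<le> length \<phi>s"
    using \<phi>s(1) by (intro b3_le_colourings) (auto simp: odd_separating_def)
  then show ?thesis using \<phi>s(2) by simp
qed

theorem corollary6:
  fixes n :: nat
  assumes "n \<ge> 3"
  shows "(even n \<longrightarrow> b3 n = n div 2) \<and>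
    (odd n \<longrightarrow> b3 n = (n - 1) div 2 \<or> b3 n = (n + 1) div 2) \<and>
    (odd n \<and> (n mod 8 = 1 \<or> (\<exists>k::nat. n = 3 ^ k)) \<longrightarrow> b3 n = (n - 1) div 2)"
proof -
  have lower: "n div 2 \<le> b3 n" using b3_lower[OF assms] .
  \<comment> \<open>An odd \<open>n\<close> is treated inside \<open>n + 1\<close> vertices; for
    even \<open>n\<close> the bound is \<open>n div 2\<close>.\<close>
  have upper: "b3 n \<le> (n + 1) div 2" by (rule b3_le_half) presburger
  have special: "b3 n \<le> (n - 1) div 2" if "n mod 8 = 1 \<or> (\<exists>k::nat. n = 3 ^ k)"
    using that b3_le_mod_8 b3_le_power_3 by auto
  show ?thesis
  proof (intro conjI impI)
    assume "even n"
    then show "b3 n = n div 2" using lower upper by auto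
  next
    assume "odd n"
    then show "b3 n = (n - 1) div 2 \<or> b3 n = (n + 1) div 2"
      using lower upper by (auto elim!: oddE)
  next
    assume "odd n \<and> (n mod 8 = 1 \<or> (\<exists>k::nat. n = 3 ^ k))"
    then show "b3 n = (n - 1) div 2" using lower special by (auto elim!: oddE)
  qed
qed

end
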